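(* Let $(X,\mathcal{S},\mu)$ be a finite measure space and let $T:X\to X$ be an invertible measure preserving transformation of $X$ onto itself, i.e. $T$ is a bijection such that for every $E\in\mathcal{S}$ the sets $T^{-1}E$ and $TE$ belong to $\mathcal{S}$ and $\mu(E)=\mu(T^{-1}E)=\mu(TE)$. Then for every $E\in\mathcal{S}$, $$\int_E n_E\, d\mu=\mu(I_E),$$ where $n_E(x):=\inf\{n\in\mathbb{Z}: n>0,\ T^n x\in E\}$ is the first return time to $E$ (possibly $+\infty$), and $I_E$ is the smallest $T$-invariant set containing $E$.
   Context: Conventions: the infimum of the empty set is $+\infty$, so $n_E$ takes values in $\{1,2,3,\dots\}\cup\{+\infty\}$, and $\int_E n_E\,d\mu$ is the integral of a nonnegative extended-real-valued measurable function. A set $A\subseteq X$ is called invariant if $T^{-1}A=A$ (equivalently $TA=A$, as $T$ is a bijection). $I_E$ denotes the smallest (with respect to inclusion) invariant set containing $E$, i.e. the intersection of all invariant sets containing $E$. No ergodicity of $T$ and no positivity of $\mu(E)$ is assumed. *)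

theory Defs
  imports "HOL-Analysis.Analysis"
begin

text \<open>The underlying set \<open>X\<close> is \<open>space M\<close>; the values of \<open>T\<close> outside \<open>space M\<close> are irrelevant, so
  preimages are intersected with \<open>space M\<close>.\<close>

definition invertible_measure_preserving :: "'a measure \<Rightarrow> ('a \<Rightarrow> 'a) \<Rightarrow> bool" where
  "invertible_measure_preserving M T \<longleftrightarrow>
     bij_betw T (space M) (space M) \<and>
     (\<forall>E\<in>sets M.
        T -` E \<inter> space M \<in> sets M \<and> T ` E \<in> sets M \<and>
        emeasure M E = emeasure M (T -` E \<inter> space M) \<and>
        emeasure M E = emeasure M (T ` E))"

text \<open>The infimum is taken in the complete lattice \<open>ennreal\<close>, so it is \<open>\<infinity>\<close> if there is no return.\<close>

definition first_return_time :: "('a \<Rightarrow> 'a) \<Rightarrow> 'a set \<Rightarrow> 'a \<Rightarrow> ennreal" where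
  "first_return_time T E x = (INF n\<in>{n::nat. n > 0 \<and> (T ^^ n) x \<in> E}. of_nat n)"

text \<open>Invariant sets are arbitrary subsets of \<open>space M\<close>, not required to be measurable.\<close>

definition invariant_set :: "'a measure \<Rightarrow> ('a \<Rightarrow> 'a) \<Rightarrow> 'a set \<Rightarrow> bool" where
  "invariant_set M T A \<longleftrightarrow> A \<subseteq> space M \<and> T -` A \<inter> space M = A"

definition invariant_hull :: "'a measure \<Rightarrow> ('a \<Rightarrow> 'a) \<Rightarrow> 'a set \<Rightarrow> 'a set" where
  "invariant_hull M T E = \<Inter>{A. invariant_set M T A \<and> E \<subseteq> A}"

lemma invariant_setI:
  assumes "A \<subseteq> space M"
    and "\<And>x. x \<in> space M \<Longrightarrow> T x \<in> A \<Longrightarrow> x \<in> A"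
    and "\<And>x. x \<in> A \<Longrightarrow> T x \<in> A"
  shows "invariant_set M T A"
  using assms by (auto simp: invariant_set_def)

lemma invariant_set_space:
  assumes "invertible_measure_preserving M T"
  shows "invariant_set M T (space M)"
  using assms bij_betw_apply
  by (fastforce simp: invertible_measure_preserving_def invariant_set_def)

lemma invariant_hull_least:
  assumes "invariant_set M T A" "E \<subseteq> A"
  shows "invariant_hull M T E \<subseteq> A"
  using assms by (auto simp: invariant_hull_def)

lemma subset_invariant_hull: "E \<subseteq> invariant_hull M T E"
  by (auto simp: invariant_hull_def)

lemma invariant_set_invariant_hull:
  assumes "invertible_measure_preserving M T" "E \<subseteq> space M"
  shows "invariant_set M T (invariant_hull M T E)"
proof -
  have "invariant_hull M T E \<subseteq> space M"
    using invariant_set_space[OF assms(1)] assms(2) by (rule invariant_hull_least)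
  then show ?thesis
  proof (rule invariant_setI)
    fix x assume "x \<in> space M" "T x \<in> invariant_hull M T E"
    then show "x \<in> invariant_hull M T E"
      unfolding invariant_hull_def invariant_set_def by blast
  next
    fix x assume "x \<in> invariant_hull M T E"
    then show "T x \<in> invariant_hull M T E"
      unfolding invariant_hull_def invariant_set_def by blast
  qed
qed

text \<open>Both sides of the return time formula are well defined: the integrand and the invariant hull
  are measurable.\<close>

lemma measurable_iterate:
  assumes "invertible_measure_preserving M T"
  shows "T ^^ n \<in> measurable M M"
proof -
  have "T \<in> measurable M M"
    using assms bij_betw_apply
    by (fastforce simp: invertible_measure_preserving_def intro!: measurableI)
  then show ?thesis
    by (rule measurable_compose_n)
qed

lemma sets_image_iterate:
  assumes "invertible_measure_preserving M T" "E \<in> sets M"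
  shows "(T ^^ n) ` E \<in> sets M"
proof (induction n)
  case 0
  then show ?case using assms by simp
next
  case (Suc n)
  have "(T ^^ Suc n) ` E = T ` ((T ^^ n) ` E)"
    by (simp add: image_image)
  then show ?case
    using Suc assms(1) unfolding invertible_measure_preserving_def by metis
qed

lemma borel_measurable_first_return_time:
  assumes "invertible_measure_preserving M T" "E \<in> sets M"
  shows "first_return_time T E \<in> borel_measurable M"
proof -
  have "first_return_time T E x =
      (INF n. if n > 0 \<and> (T ^^ n) x \<in> E then of_nat n else top)" for x
  proof (rule antisym)
    show "first_return_time T E x \<le> (INF n. if n > 0 \<and> (T ^^ n) x \<in> E then of_nat n else top)"
      unfolding first_return_time_def by (rule INF_greatest) (auto intro: INF_lower)
    show "(INF n. if n > 0 \<and> (T ^^ n) x \<in> E then of_nat n else top) \<le> first_return_time T E x"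
      unfolding first_return_time_def
    proof (rule INF_greatest)
      fix n assume "n \<in> {n::nat. n > 0 \<and> (T ^^ n) x \<in> E}"
      then show "(INF n. if n > 0 \<and> (T ^^ n) x \<in> E then of_nat n else top) \<le> (of_nat n :: ennreal)"
        by (intro INF_lower2[of n]) simp_all
    qed
  qed
  moreover have "(\<lambda>x. INF n. if n > 0 \<and> (T ^^ n) x \<in> E then of_nat n else (top::ennreal))
      \<in> borel_measurable M"
  proof (intro borel_measurable_INF)
    fix n :: nat
    have [measurable]: "T ^^ n \<in> measurable M M" "E \<in> sets M"
      using measurable_iterate assms by blast+
    show "(\<lambda>x. if n > 0 \<and> (T ^^ n) x \<in> E then of_nat n else (top::ennreal)) \<in> borel_measurable M"
      by measurable
  qed auto
  ultimately show ?thesis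
    by presburger
qed

lemma invariant_hull_eq:
  assumes T: "invertible_measure_preserving M T" and E: "E \<subseteq> space M"
  shows "invariant_hull M T E =
    (\<Union>n. (T ^^ n) ` E) \<union> (\<Union>n. (T ^^ n) -` E \<inter> space M)" (is "_ = ?U \<union> ?V")
proof
  have bij: "bij_betw T (space M) (space M)"
    using T by (simp add: invertible_measure_preserving_def)
  then have Tsp: "T x \<in> space M" if "x \<in> space M" for x
    using that bij_betw_apply by fastforce
  have itsp: "(T ^^ n) x \<in> space M" if "x \<in> space M" for x n
    using that Tsp by (induction n) auto
  have "x \<in> ?U \<union> ?V" if x: "x \<in> space M" "T x \<in> ?U \<union> ?V" for x
  proof -
    consider n e where "e \<in> E" "T x = (T ^^ n) e" | n where "(T ^^ n) (T x) \<in> E"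
      using x(2) by auto
    then show ?thesis
    proof cases
      case (1 n e)
      show ?thesis
      proof (cases n)
        case 0
        then have "(T ^^ 1) x \<in> E" using 1 by simp
        then show ?thesis using x(1) by blast
      next
        case (Suc m)
        then have "T x = T ((T ^^ m) e)" using 1 by simp
        then have "x = (T ^^ m) e"
          using bij x(1) itsp E 1(1) by (meson bij_betw_def inj_onD subsetD)
        then show ?thesis using 1 by blast
      qed
    next
      case (2 n)
      then have "(T ^^ Suc n) x \<in> E" by (simp add: funpow_swap1)
      then show ?thesis using x(1) by blast
    qed
  qed
  note preimg = this
  have img: "T x \<in> ?U \<union> ?V" if x: "x \<in> ?U \<union> ?V" for x
  proof -
    consider n e where "e \<in> E" "x = (T ^^ n) e" | n where "(T ^^ n) x \<in> E" "x \<in> space M"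
      using x by auto
    then show ?thesis
    proof cases
      case (1 n e)
      then have "T x = (T ^^ Suc n) e" by simp
      then show ?thesis using 1 by blast
    next
      case (2 n)
      show ?thesis
      proof (cases n)
        case 0
        then have "T x = (T ^^ 1) x" "x \<in> E" using 2 by auto
        then show ?thesis by blast
      next
        case (Suc m)
        then have "(T ^^ m) (T x) \<in> E" using 2 by (simp add: funpow_swap1)
        then show ?thesis using Tsp 2 by blast
      qed
    qed
  qed
  have "?U \<subseteq> space M" "?V \<subseteq> space M"
    using E itsp by auto
  then have "?U \<union> ?V \<subseteq> space M"
    by (rule Un_least)
  then have "invariant_set M T (?U \<union> ?V)"
    using preimg img by (rule invariant_setI)
  moreover have "E \<subseteq> ?U \<union> ?V"
  proof -
    have "E = (T ^^ 0) ` E" by simp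
    also have "\<dots> \<subseteq> ?U" by (rule UN_upper) simp
    finally show ?thesis by (rule le_supI1)
  qed
  ultimately show "invariant_hull M T E \<subseteq> ?U \<union> ?V"
    by (rule invariant_hull_least)
next
  let ?H = "invariant_hull M T E"
  have inv: "x \<in> ?H \<longleftrightarrow> T x \<in> ?H" if "x \<in> space M" for x
    using invariant_set_invariant_hull[OF T E] that by (auto simp: invariant_set_def)
  have Tsp: "T x \<in> space M" if "x \<in> space M" for x
    using T that bij_betw_apply by (fastforce simp: invertible_measure_preserving_def)
  have itsp: "(T ^^ n) x \<in> space M" if "x \<in> space M" for x n
    using that Tsp by (induction n) auto
  have "x \<in> ?H \<longleftrightarrow> (T ^^ n) x \<in> ?H" if "x \<in> space M" for x n
    using that inv itsp by (induction n) auto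
  then show "?U \<union> ?V \<subseteq> ?H"
    using E subset_invariant_hull[of E M T] by blast
qed

lemma sets_invariant_hull:
  assumes "invertible_measure_preserving M T" "E \<in> sets M"
  shows "invariant_hull M T E \<in> sets M"
proof -
  have "(T ^^ n) -` E \<inter> space M \<in> sets M" for n
    using measurable_iterate[OF assms(1)] assms(2) by (rule measurable_sets)
  then have "(\<Union>n. (T ^^ n) ` E) \<union> (\<Union>n. (T ^^ n) -` E \<inter> space M) \<in> sets M"
    by (intro sets.Un sets.countable_UN) (use sets_image_iterate[OF assms] in blast)+
  then show ?thesis
    using invariant_hull_eq[OF assms(1) sets.sets_into_space[OF assms(2)]] by simp
qed

end

theory Submission
  imports Defs
begin

text \<open>Let \<open>A k\<close> be the set of points of \<open>E\<close> that do not return to \<open>E\<close> within \<open>k\<close> steps, so that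
  \<open>n\<^sub>E = (\<Sum>k. indicator (A k))\<close> on \<open>E\<close>. A point \<open>y\<close> of the forward orbit \<open>U\<close> of \<open>E\<close> lies in \<open>T\<^sup>k (A k)\<close>
  exactly for the least \<open>k\<close> with \<open>y \<in> T\<^sup>k E\<close>, so the sets \<open>T\<^sup>k (A k)\<close> partition \<open>U\<close>.
  Hence the integral equals \<open>\<mu> U\<close>. Finally \<open>I\<^sub>E\<close> is the increasing
  union of the preimages \<open>T\<^sup>-\<^sup>n U\<close>, all of which have measure \<open>\<mu> U\<close>.\<close>

lemma funpow_mem_space:
  assumes "invertible_measure_preserving M T" "x \<in> space M"
  shows "(T ^^ n) x \<in> space M"
  using measurable_space[OF measurable_iterate[OF assms(1)] assms(2)] .

lemma inj_on_funpow_space: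
  assumes "invertible_measure_preserving M T"
  shows "inj_on (T ^^ n) (space M)"
proof -
  have "bij_betw T (space M) (space M)"
    using assms by (simp add: invertible_measure_preserving_def)
  then show ?thesis
    using bij_betw_funpow bij_betw_imp_inj_on by blast
qed

lemma emeasure_image_iterate:
  assumes "invertible_measure_preserving M T" "A \<in> sets M"
  shows "emeasure M ((T ^^ n) ` A) = emeasure M A"
proof (induction n)
  case (Suc n)
  have "(T ^^ Suc n) ` A = T ` ((T ^^ n) ` A)"
    by (simp add: image_image)
  then show ?case
    using Suc assms(1) sets_image_iterate[OF assms]
    unfolding invertible_measure_preserving_def by metis
qed simp

lemma emeasure_vimage_iterate:
  assumes "invertible_measure_preserving M T" "A \<in> sets M"
  shows "emeasure M ((T ^^ n) -` A \<inter> space M) = emeasure M A"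
proof (induction n)
  case 0
  then show ?case
    using sets.sets_into_space[OF assms(2)] by (simp add: Int_absorb2)
next
  case (Suc n)
  \<comment> \<open>Since \<open>T\<close> maps \<open>space M\<close> into itself, the inner
    intersection removes nothing; it makes the set a preimage under \<open>T\<close> of a measurable
    set, to which the invariance of the measure applies.\<close>
  have "(T ^^ Suc n) -` A \<inter> space M = T -` ((T ^^ n) -` A \<inter> space M) \<inter> space M"
    using funpow_mem_space[OF assms(1), where n = 1] by (auto simp: funpow_swap1)
  moreover have "(T ^^ n) -` A \<inter> space M \<in> sets M"
    using measurable_iterate[OF assms(1)] assms(2) by (rule measurable_sets)
  ultimately show ?case
    using Suc assms(1) unfolding invertible_measure_preserving_def by metis
qed

text \<open>Membership in \<open>E\<close> is left out, so that the series for the return time holds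
  at every point; \<open>E \<inter> no_return T E k\<close> is the set \<open>A k\<close>
  above.\<close>

definition no_return :: "('a \<Rightarrow> 'a) \<Rightarrow> 'a set \<Rightarrow> nat \<Rightarrow> 'a set" where
  "no_return T E k = {x. \<forall>n\<in>{1..k}. (T ^^ n) x \<notin> E}"

lemma sets_no_return:
  assumes "invertible_measure_preserving M T" "E \<in> sets M"
  shows "E \<inter> no_return T E k \<in> sets M"
proof -
  have [measurable]: "T ^^ n \<in> measurable M M" "E \<in> sets M" for n
    using measurable_iterate assms by blast+
  have "E \<inter> no_return T E k = {x\<in>space M. x \<in> E \<and> (\<forall>n\<in>{1..k}. (T ^^ n) x \<notin> E)}"
    using sets.sets_into_space[OF assms(2)] by (auto simp: no_return_def)
  also have "\<dots> \<in> sets M"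
    by measurable
  finally show ?thesis .
qed

text \<open>A point lies in \<open>no_return T E k\<close> exactly when \<open>k\<close> is smaller
  than its return time, so the series counts the naturals below that time.\<close>

lemma first_return_time_eq_suminf:
  "first_return_time T E x = (\<Sum>k. indicator (no_return T E k) x)"
proof (cases "\<exists>n>0. (T ^^ n) x \<in> E")
  case True
  define m where "m = (LEAST n. n > 0 \<and> (T ^^ n) x \<in> E)"
  have m: "m > 0" "(T ^^ m) x \<in> E"
    using LeastI_ex[OF True] by (simp_all add: m_def)
  have least: "m \<le> n" if "n > 0" "(T ^^ n) x \<in> E" for n
    using that by (simp add: m_def Least_le)
  \<comment> \<open>The index \<open>0\<close> always qualifies because \<open>{1..0}\<close> is
    empty, so exactly the \<open>m\<close> indices from \<open>0\<close> to \<open>m - 1\<close>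
    contribute.\<close>
  have iff: "x \<in> no_return T E k \<longleftrightarrow> k < m" for k
  proof
    assume "x \<in> no_return T E k"
    then show "k < m"
      using m by (cases "k < m") (auto simp: no_return_def)
  next
    assume "k < m"
    then show "x \<in> no_return T E k"
      unfolding no_return_def by (auto dest!: least[rotated])
  qed
  have "first_return_time T E x = of_nat m"
    unfolding first_return_time_def
  proof (rule antisym)
    show "(INF n\<in>{n. n > 0 \<and> (T ^^ n) x \<in> E}. of_nat n) \<le> (of_nat m :: ennreal)"
      using m by (intro INF_lower) simp
    show "of_nat m \<le> (INF n\<in>{n. n > 0 \<and> (T ^^ n) x \<in> E}. of_nat n :: ennreal)"
      using least by (intro INF_greatest) simp
  qed
  also have "\<dots> = (\<Sum>k<m. indicator (no_return T E k) x)"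
    by (simp add: iff indicator_def)
  also have "\<dots> = (\<Sum>k. indicator (no_return T E k) x)"
    by (rule suminf_finite[symmetric]) (simp_all add: iff)
  finally show ?thesis .
next
  case False
  then have "(T ^^ n) x \<notin> E" if "n > 0" for n
    using that by blast
  then have mem: "x \<in> no_return T E k" for k
    by (simp add: no_return_def)
  from False have "first_return_time T E x = top"
    by (auto simp: first_return_time_def)
  \<comment> \<open>Without a return every term is \<open>1\<close>, so the series exceeds each
    natural number, which in \<open>ennreal\<close> forces it to be \<open>top\<close>.\<close>
  moreover have "of_nat n \<le> (\<Sum>k. indicator (no_return T E k) x :: ennreal)" for n
  proof -
    have "of_nat n = (\<Sum>k<n. indicator (no_return T E k) x :: ennreal)"
      by (simp add: mem)
    also have "\<dots> \<le> (\<Sum>k. indicator (no_return T E k) x)"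
      by (intro sum_le_suminf) auto
    finally show ?thesis .
  qed
  then have "\<not> (\<Sum>k. indicator (no_return T E k) x :: ennreal) < top"
    using ennreal_Ex_less_of_nat by (meson leD)
  then have "(\<Sum>k. indicator (no_return T E k) x :: ennreal) = top"
    using less_top by blast
  ultimately show ?thesis by simp
qed

text \<open>If two images with exponents \<open>n < m\<close> met, cancelling \<open>T ^^ n\<close>
  by injectivity would give a return to \<open>E\<close> after \<open>m - n\<close> steps, although
  the point used for \<open>m\<close> has none within \<open>m\<close> steps.\<close>

lemma disjoint_family_image_no_return:
  assumes "invertible_measure_preserving M T" "E \<subseteq> space M"
  shows "disjoint_family (\<lambda>k. (T ^^ k) ` (E \<inter> no_return T E k))"
proof -
  have ne: "(T ^^ n) x \<noteq> (T ^^ m) y"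
    if "n < m" "x \<in> E" "y \<in> E" "y \<in> no_return T E m" for n m x y
  proof
    assume "(T ^^ n) x = (T ^^ m) y"
    also have "\<dots> = (T ^^ n) ((T ^^ (m - n)) y)"
      using that(1) funpow_add[of n "m - n" T] by simp
    finally have "x = (T ^^ (m - n)) y"
    proof (rule inj_onD[OF inj_on_funpow_space[OF assms(1)]])
      show "x \<in> space M" "(T ^^ (m - n)) y \<in> space M"
        using assms(2) that(2,3) funpow_mem_space[OF assms(1)] by auto
    qed
    moreover have "m - n \<in> {1..m}" using that(1) by auto
    ultimately show False
      using that(2,4) by (simp add: no_return_def)
  qed
  show ?thesis
    unfolding disjoint_family_on_def
  proof (intro ballI impI)
    fix m n :: nat assume "m \<noteq> n"
    then consider "m < n" | "n < m" by linarith
    then show "(T ^^ m) ` (E \<inter> no_return T E m) \<inter> (T ^^ n) ` (E \<inter> no_return T E n) = {}"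
    proof cases
      case 1
      show ?thesis using ne[OF 1] by blast
    next
      case 2
      show ?thesis using ne[OF 2] by (fastforce dest: sym)
    qed
  qed
qed

lemma UN_image_no_return: "(\<Union>k. (T ^^ k) ` (E \<inter> no_return T E k)) = (\<Union>k. (T ^^ k) ` E)"
proof
  show "(\<Union>k. (T ^^ k) ` E) \<subseteq> (\<Union>k. (T ^^ k) ` (E \<inter> no_return T E k))"
  proof
    fix y assume "y \<in> (\<Union>k. (T ^^ k) ` E)"
    then have ex: "\<exists>k. y \<in> (T ^^ k) ` E" by blast
    define m where "m = (LEAST k. y \<in> (T ^^ k) ` E)"
    obtain e where e: "e \<in> E" "y = (T ^^ m) e"
      using LeastI_ex[OF ex] by (auto simp: m_def)
    have "(T ^^ j) e \<notin> E" if j: "j \<in> {1..m}" for j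
    proof
      \<comment> \<open>A return of \<open>e\<close> at time \<open>j\<close> would place
        \<open>y\<close> in the image of \<open>E\<close> under the smaller power
        \<open>m - j\<close>, against the minimality of \<open>m\<close>.\<close>
      assume "(T ^^ j) e \<in> E"
      moreover have "y = (T ^^ (m - j)) ((T ^^ j) e)"
        using j e(2) by (metis atLeastAtMost_iff comp_apply funpow_add le_add_diff_inverse2)
      ultimately have "m \<le> m - j"
        unfolding m_def by (intro Least_le) blast
      then show False using j by auto
    qed
    then have "e \<in> E \<inter> no_return T E m"
      using e(1) by (simp add: no_return_def)
    then show "y \<in> (\<Union>k. (T ^^ k) ` (E \<inter> no_return T E k))"
      using e(2) by blast
  qed
qed auto

text \<open>Integrating the series termwise gives the sum of the measures of the \<open>A k\<close>;
  moving each by \<open>T ^^ k\<close> keeps its measure and makes the sets disjoint, so countable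
  additivity applies.\<close>

lemma nn_integral_first_return_time:
  assumes T: "invertible_measure_preserving M T" and E: "E \<in> sets M"
  shows "(\<integral>\<^sup>+x\<in>E. first_return_time T E x \<partial>M) = emeasure M (\<Union>k. (T ^^ k) ` E)"
proof -
  let ?A = "\<lambda>k. E \<inter> no_return T E k"
  have "(\<integral>\<^sup>+x\<in>E. first_return_time T E x \<partial>M) = (\<integral>\<^sup>+x. (\<Sum>k. indicator (?A k) x) \<partial>M)"
    by (intro nn_integral_cong) (auto simp: first_return_time_eq_suminf indicator_def)
  also have "\<dots> = (\<Sum>k. emeasure M (?A k))"
    using sets_no_return[OF T E] by (simp add: nn_integral_suminf)
  also have "\<dots> = (\<Sum>k. emeasure M ((T ^^ k) ` ?A k))"
    using emeasure_image_iterate[OF T sets_no_return[OF T E]] by simp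
  also have "\<dots> = emeasure M (\<Union>k. (T ^^ k) ` ?A k)"
    using sets_image_iterate[OF T sets_no_return[OF T E]]
      disjoint_family_image_no_return[OF T sets.sets_into_space[OF E]]
    by (intro suminf_emeasure) blast+
  finally show ?thesis
    by (simp only: UN_image_no_return)
qed

lemma emeasure_invariant_hull:
  assumes T: "invertible_measure_preserving M T" and E: "E \<in> sets M"
  shows "emeasure M (invariant_hull M T E) = emeasure M (\<Union>k. (T ^^ k) ` E)"
proof -
  define U where "U = (\<Union>k. (T ^^ k) ` E)"
  let ?B = "\<lambda>n. (T ^^ n) -` U \<inter> space M"
  have U: "U \<in> sets M"
    unfolding U_def using sets_image_iterate[OF T E] by blast
  have B: "range ?B \<subseteq> sets M"
    using measurable_sets[OF measurable_iterate[OF T] U] by blast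
  \<comment> \<open>Forward invariance of \<open>U\<close> is what makes its preimages increase: an
    orbit that has entered \<open>U\<close> stays there.\<close>
  have TU: "T y \<in> U" if y: "y \<in> U" for y
  proof -
    obtain k e where "e \<in> E" "y = (T ^^ k) e"
      using y by (auto simp: U_def)
    then have "T y = (T ^^ Suc k) e" by simp
    then show ?thesis using \<open>e \<in> E\<close> unfolding U_def by blast
  qed
  have "incseq ?B"
    by (intro incseq_SucI subsetI IntI vimageI2) (simp_all add: TU)
  let ?H = "invariant_hull M T E"
  have H_inv: "T x \<in> ?H \<longleftrightarrow> x \<in> ?H" if "x \<in> space M" for x
    using invariant_set_invariant_hull[OF T sets.sets_into_space[OF E]] that
    by (auto simp: invariant_set_def)
  have H_it: "(T ^^ n) x \<in> ?H \<longleftrightarrow> x \<in> ?H" if "x \<in> space M" for x n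
    by (induction n) (simp_all add: H_inv funpow_mem_space[OF T] that)
  have hull: "?H = U \<union> (\<Union>n. (T ^^ n) -` E \<inter> space M)"
    unfolding U_def using invariant_hull_eq[OF T sets.sets_into_space[OF E]] .
  have E_U: "E \<subseteq> U"
    using UN_upper[of 0 UNIV "\<lambda>k. (T ^^ k) ` E"] by (simp add: U_def)
  have U_B: "U \<subseteq> ?B 0"
    using sets.sets_into_space[OF U] by simp
  have "?H = (\<Union>n. ?B n)"
  proof
    show "(\<Union>n. ?B n) \<subseteq> ?H"
    proof (intro UN_least subsetI)
      fix n x assume "x \<in> ?B n"
      then have "x \<in> space M" "(T ^^ n) x \<in> U"
        by auto
      moreover from this(2) have "(T ^^ n) x \<in> ?H"
        unfolding hull by (rule UnI1)
      ultimately show "x \<in> ?H"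
        using H_it by simp
    qed
    \<comment> \<open>The forward images in the hull are covered by the preimage with
      \<open>n = 0\<close>, the backward ones by \<open>E \<subseteq> U\<close>.\<close>
    have "U \<subseteq> (\<Union>n. ?B n)"
      using U_B by (rule order_trans) (rule UN_upper, simp)
    moreover have "(T ^^ n) -` E \<inter> space M \<subseteq> ?B n" for n
      using E_U by blast
    ultimately show "?H \<subseteq> (\<Union>n. ?B n)"
      unfolding hull by (intro Un_least UN_mono order_refl)
  qed
  \<comment> \<open>Continuity from below turns the measure of the union into a supremum, here of a
    constant sequence.\<close>
  also have "emeasure M \<dots> = (SUP n. emeasure M (?B n))"
    using SUP_emeasure_incseq[OF B \<open>incseq ?B\<close>] by simp
  also have "\<dots> = emeasure M U"
    using emeasure_vimage_iterate[OF T U] by simp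
  finally show ?thesis
    by (simp only: U_def)
qed

theorem theorem0p1:
  fixes M :: "'a measure" and T :: "'a \<Rightarrow> 'a" and E :: "'a set"
  assumes "finite_measure M"
    and "invertible_measure_preserving M T"
    and "E \<in> sets M"
  shows "(\<integral>\<^sup>+x\<in>E. first_return_time T E x \<partial>M) = emeasure M (invariant_hull M T E)"
  using nn_integral_first_return_time[OF assms(2,3)] emeasure_invariant_hull[OF assms(2,3)]
  by simp

end
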